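(* Let $G$ be a connected graph of order $n\geq 5$, size $m$ (number of edges), minimum degree $\delta\geq 2$ and vertex-connectivity $\kappa$. (a) If $m \geq \binom{n-2}{2}+2\delta-1$, then $\kappa=\delta$, unless $G\cong K_{\delta-1}\vee (K_2\cup K_{n-\delta-1})$. (b) If $n\geq 2\delta+3$ and $m \geq \binom{n-2}{2}+\delta$, then $\kappa=\delta$, unless $G$ is isomorphic to a subgraph of $K_{\delta-1}\vee (K_2\cup K_{n-\delta-1})$.
   Context: All graphs are finite, simple and undirected. The vertex-connectivity $\kappa(G)$ of a connected non-complete graph is the minimum size of a vertex set whose removal disconnects $G$, and $\kappa(K_n)=n-1$. $K_r$ is the complete graph on $r$ vertices, $\cup$ is disjoint union and $G_1\vee G_2$ is the join (disjoint union plus all edges between $G_1$ and $G_2$). *)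

theory Defs
  imports "Graph_Theory.Graph_Theory"
begin

text \<open>
  Finite simple undirected graphs are represented as in the Graph\_Theory entry: by
  \<^locale>\<open>pair_graph\<close>s, i.e. finite loop-free digraphs without parallel arcs whose arc relation
  is symmetric. An undirected edge \<open>uv\<close> corresponds to the two arcs \<open>(u, v)\<close> and \<open>(v, u)\<close>.
\<close>

definition edges :: "'a pair_pre_digraph \<Rightarrow> 'a set set" where
  "edges G = (\<lambda>(u, v). {u, v}) ` parcs G"

text \<open>In a symmetric digraph the out-degree of a vertex is its number of neighbours.\<close>

definition min_degree :: "'a pair_pre_digraph \<Rightarrow> nat" where
  "min_degree G = Min (out_degree G ` pverts G)"

text \<open>
  Only proper vertex subsets are removed, so that at least one vertex remains; the empty graph does
  not count as connected for \<^const>\<open>Digraph_Component.connected\<close>.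
\<close>

definition vertex_connectivity :: "'a pair_pre_digraph \<Rightarrow> nat" where
  "vertex_connectivity G =
     (if complete_digraph (card (pverts G)) G then card (pverts G) - 1
      else Min {card S | S. S \<subset> pverts G \<and>
        \<not> Digraph_Component.connected (induce_subgraph G (pverts G - S))})"

definition complete_graph :: "nat \<Rightarrow> nat pair_pre_digraph" where
  "complete_graph r = \<lparr> pverts = {..<r}, parcs = {(u, v). u < r \<and> v < r \<and> u \<noteq> v} \<rparr>"

definition disjoint_union ::
  "'a pair_pre_digraph \<Rightarrow> 'b pair_pre_digraph \<Rightarrow> ('a + 'b) pair_pre_digraph" where
  "disjoint_union G H =
     \<lparr> pverts = pverts G <+> pverts H,
       parcs = map_prod Inl Inl ` parcs G \<union> map_prod Inr Inr ` parcs H \<rparr>"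

definition join ::
  "'a pair_pre_digraph \<Rightarrow> 'b pair_pre_digraph \<Rightarrow> ('a + 'b) pair_pre_digraph" where
  "join G H =
     \<lparr> pverts = pverts (disjoint_union G H),
       parcs = parcs (disjoint_union G H)
         \<union> (Inl ` pverts G) \<times> (Inr ` pverts H) \<union> (Inr ` pverts H) \<times> (Inl ` pverts G) \<rparr>"

definition exceptional_graph :: "nat \<Rightarrow> nat \<Rightarrow> (nat + (nat + nat)) pair_pre_digraph" where
  "exceptional_graph n d =
     join (complete_graph (d - 1))
       (disjoint_union (complete_graph 2) (complete_graph (n - d - 1)))"

lemma complete_digraph_complete_graph: "complete_digraph r (complete_graph r)"
  by (auto simp: complete_digraph_pair_def complete_graph_def)

lemma pair_graph_complete_graph: "pair_graph (complete_graph r)"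
  using complete_digraph_complete_graph by (rule pair_graphI_complete)

lemma pair_graph_join_aux:
  assumes "pair_graph G" "pair_graph H"
  shows pair_graph_disjoint_union: "pair_graph (disjoint_union G H)"
    and pair_graph_join: "pair_graph (join G H)"
proof -
  interpret G: pair_graph G by fact
  interpret H: pair_graph H by fact
  have symG: "(v, u) \<in> parcs G" if "(u, v) \<in> parcs G" for u v
    using that G.graph_symmetric by simp
  have symH: "(v, u) \<in> parcs H" if "(u, v) \<in> parcs H" for u v
    using that H.graph_symmetric by simp
  note defs = join_def disjoint_union_def symmetric_def sym_def
  note wf = G.wellformed' H.wellformed' G.pair_finite_verts H.pair_finite_verts
    G.pair_finite_arcs H.pair_finite_arcs
  have nl: "(u, u) \<notin> parcs G" "(w, w) \<notin> parcs H" for u w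
    using G.pair_no_loops H.pair_no_loops by fastforce+
  show "pair_graph (disjoint_union G H)"
    by unfold_locales (use symG symH nl in \<open>force simp: defs map_prod_def intro: wf\<close>)+
  show "pair_graph (join G H)"
    by unfold_locales (use symG symH nl in \<open>force simp: defs map_prod_def intro: wf\<close>)+
qed

end

(* If kappa < delta, remove a minimum cut S; the rest splits into nonempty parts A and B without
   edges between them, so m + |A| |B| <= n choose 2. A vertex of A has all its neighbours in A and S,
   hence |A|, |B| >= delta - |S| + 1 >= 2. The lower bound on m therefore forces |S| = delta - 1 and
   that the smaller part has size 2. In (a) the edge count is then tight, so every pair outside A x B
   is an edge. In (b) the only other candidate is K_(delta-1) join (K_3 union K_(delta+1)), whose
   minimum degree exceeds delta. *)
theory Submission
  imports Defs
begin

section \<open>Separations from disconnecting sets\<close>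

definition separation :: "'a pair_pre_digraph \<Rightarrow> 'a set \<Rightarrow> 'a set \<Rightarrow> 'a set \<Rightarrow> bool" where
  "separation G S A B \<longleftrightarrow>
     pverts G = S \<union> A \<union> B \<and> S \<inter> A = {} \<and> S \<inter> B = {} \<and> A \<inter> B = {} \<and> A \<noteq> {} \<and> B \<noteq> {} \<and>
     parcs G \<inter> (A \<times> B \<union> B \<times> A) = {}"

lemma separation_swap: "separation G S A B \<Longrightarrow> separation G S B A"
  by (auto simp: separation_def)

text \<open>After deleting \<open>S\<close>, take for \<open>A\<close> everything reachable from one
  vertex of an unconnected pair and for \<open>B\<close> the rest, which contains the other
  vertex.\<close>

lemma disconnected_imp_separation:
  assumes "pair_graph G" "S \<subset> pverts G"
    and "\<not> Digraph_Component.connected (induce_subgraph G (pverts G - S))"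
  shows "\<exists>A B. separation G S A B"
proof -
  interpret pair_graph G by fact
  define W where "W = pverts G - S"
  define R where "R = rtrancl_on W ((arcs_ends (induce_subgraph G W))\<^sup>s)"
  \<comment> \<open>The empty graph also fails to be connected. Since \<open>W\<close> is nonempty,
    the failure must come from an unreachable pair.\<close>
  have "W \<noteq> {}"
    using assms(2) by (auto simp: W_def)
  then obtain u v where uv: "u \<in> W" "v \<in> W" "(u, v) \<notin> R"
    using assms(3) unfolding connected_conv R_def W_def by auto
  define A where "A = {w \<in> W. (u, w) \<in> R}"
  have step: "(u, y) \<in> R" if "(u, x) \<in> R" "(x, y) \<in> parcs G" "x \<in> W" "y \<in> W" for x y
  proof -
    have "(x, y) \<in> arcs_ends (induce_subgraph G W)"
      using that by (force simp: arcs_ends_def arc_to_ends_def)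
    then show ?thesis
      using that unfolding R_def
      by (auto intro: rtrancl_on_into_rtrancl_on simp: symcl_def)
  qed
  have sym: "(y, x) \<in> parcs G" if "(x, y) \<in> parcs G" for x y
    using that by (rule arcs_symmetric)
  have "(u, u) \<in> R"
    using uv by (auto simp: R_def)
  then have "u \<in> A" "v \<in> W - A"
    using uv by (auto simp: A_def)
  moreover have "(x, y) \<notin> parcs G" if "x \<in> A" "y \<in> W - A" for x y
    using step that by (auto simp: A_def)
  ultimately have "separation G S A (W - A)"
    using assms(2) sym unfolding separation_def by (auto simp: A_def W_def)
  then show ?thesis by blast
qed

section \<open>Neighbourhoods and minimum degree\<close>

context pair_graph
begin

lemma out_degree_eq_card_neighbours: "out_degree G v = card {w. (v, w) \<in> parcs G}"
proof -
  have "out_arcs G v = Pair v ` {w. (v, w) \<in> parcs G}"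
    by (auto simp: out_arcs_def)
  then show ?thesis
    by (simp add: out_degree_def card_image inj_on_def)
qed

lemma min_degree_le: "v \<in> pverts G \<Longrightarrow> min_degree G \<le> card {w. (v, w) \<in> parcs G}"
  unfolding min_degree_def out_degree_eq_card_neighbours
  by (intro Min_le) (auto simp: pair_finite_verts)

lemma min_degree_attained:
  assumes "pverts G \<noteq> {}"
  obtains v where "v \<in> pverts G" "card {w. (v, w) \<in> parcs G} = min_degree G"
proof -
  have "min_degree G \<in> out_degree G ` pverts G"
    unfolding min_degree_def using assms by (intro Min_in) (auto simp: pair_finite_verts)
  then show ?thesis
    using that by (auto simp: out_degree_eq_card_neighbours)
qed

lemma no_loop: "(v, v) \<notin> parcs G"
  using no_loops' by blast

lemma neighbours_subset: "{w. (v, w) \<in> parcs G} \<subseteq> pverts G - {v}"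
  using wellformed' no_loop by auto

lemma min_degree_complete:
  assumes "complete_digraph (card (pverts G)) G" "pverts G \<noteq> {}"
  shows "min_degree G = card (pverts G) - 1"
proof -
  obtain v where v: "v \<in> pverts G" "card {w. (v, w) \<in> parcs G} = min_degree G"
    using min_degree_attained assms(2) by blast
  have "{w. (v, w) \<in> parcs G} = pverts G - {v}"
    using assms(1) v(1) by (auto simp: complete_digraph_pair_def)
  then show ?thesis
    using v by simp
qed

text \<open>An end of a missing edge has a non-neighbour other than itself. Strictness matters: a
  vertex of minimum degree then misses some other vertex, so its neighbourhood is a cut.\<close>

lemma min_degree_not_complete:
  assumes "\<not> complete_digraph (card (pverts G)) G" "pverts G \<noteq> {}"
  shows "min_degree G < card (pverts G) - 1"
proof -
  obtain u v where uv: "u \<in> pverts G" "v \<in> pverts G" "u \<noteq> v" "(u, v) \<notin> parcs G"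
    using assms(1) wellformed' no_loop pair_finite_verts
    unfolding complete_digraph_pair_def by fast
  have "min_degree G \<le> card {w. (u, w) \<in> parcs G}"
    using uv by (intro min_degree_le)
  also have "\<dots> < card (pverts G - {u})"
    using uv neighbours_subset[of u] pair_finite_verts by (intro psubset_card_mono) auto
  finally show ?thesis
    using uv by simp
qed

section \<open>Vertex-connectivity against minimum degree\<close>

text \<open>Without its neighbours \<open>v\<close> is isolated, and the second hypothesis leaves
  another vertex that no walk from \<open>v\<close> can reach.\<close>

lemma disconnected_remove_neighbours:
  assumes "v \<in> pverts G" "{w. (v, w) \<in> parcs G} \<noteq> pverts G - {v}"
  shows "\<not> Digraph_Component.connected (induce_subgraph G (pverts G - {w. (v, w) \<in> parcs G}))"
    (is "\<not> Digraph_Component.connected (induce_subgraph G ?W)")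
proof
  let ?r = "(arcs_ends (induce_subgraph G ?W))\<^sup>s"
  assume "Digraph_Component.connected (induce_subgraph G ?W)"
  moreover obtain u where u: "u \<in> ?W" "u \<noteq> v"
    using assms neighbours_subset[of v] by auto
  moreover have "v \<in> ?W"
    using assms no_loop by auto
  ultimately have "(v, u) \<in> rtrancl_on ?W ?r"
    by (auto simp: connected_conv)
  moreover have "y = v" if "(v, y) \<in> rtrancl_on ?W ?r" for y
    using that
  proof (induct rule: rtrancl_on_induct)
    case (step y z)
    then show ?case
      using arcs_symmetric by (auto simp: symcl_def arcs_ends_def arc_to_ends_def)
  qed auto
  ultimately show False
    using u by blast
qed

text \<open>For a complete graph both parameters are one less than the order. Otherwise the
  neighbourhood of a vertex of minimum degree is a cut, so a minimum cut either has exactly that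
  size or is smaller and yields the separation.\<close>

lemma vertex_connectivity_cases:
  assumes "pverts G \<noteq> {}"
  obtains (eq) "vertex_connectivity G = min_degree G"
  | (less) S A B where "separation G S A B" "card S < min_degree G"
proof (cases "complete_digraph (card (pverts G)) G")
  case True
  then show ?thesis
    using eq min_degree_complete assms by (simp add: vertex_connectivity_def)
next
  case False
  let ?C = "{S. S \<subset> pverts G \<and> \<not> Digraph_Component.connected (induce_subgraph G (pverts G - S))}"
  have kappa: "vertex_connectivity G = Min (card ` ?C)"
    using False by (auto simp: vertex_connectivity_def setcompr_eq_image)
  have fin: "finite ?C"
    using pair_finite_verts by (auto intro: finite_subset[of _ "Pow (pverts G)"])
  obtain v where v: "v \<in> pverts G" "card {w. (v, w) \<in> parcs G} = min_degree G"
    using min_degree_attained assms by blast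
  have "{w. (v, w) \<in> parcs G} \<noteq> pverts G - {v}"
    using min_degree_not_complete[OF False assms] v by (metis card_Diff_singleton less_irrefl)
  \<comment> \<open>This cut bounds the minimum from above and also shows that \<open>?C\<close> is
    nonempty, so that \<open>Min\<close> is attained.\<close>
  then have C: "{w. (v, w) \<in> parcs G} \<in> ?C"
    using disconnected_remove_neighbours[of v] v neighbours_subset[of v] by auto
  then have le: "vertex_connectivity G \<le> min_degree G"
    unfolding kappa v(2)[symmetric] using fin by (intro Min_le) auto
  have "vertex_connectivity G \<in> card ` ?C"
    unfolding kappa using C fin by (intro Min_in) auto
  then obtain S where S: "vertex_connectivity G = card S" "S \<in> ?C"
    by (rule imageE)
  then obtain A B where "separation G S A B"
    using disconnected_imp_separation[OF pair_graph] by blast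
  then show ?thesis
    using eq less S le by (cases "card S < min_degree G") auto
qed

section \<open>Edge and degree counts for a separation\<close>

text \<open>The pairs joining \<open>A\<close> to \<open>B\<close> are non-edges, so they and the
  edges are disjoint families of 2-subsets of the vertex set. Equality means that together they
  exhaust all 2-subsets.\<close>

lemma card_edges_separation:
  assumes "separation G S A B"
  shows "card (edges G) + card A * card B \<le> card (pverts G) choose 2"
    and "\<lbrakk>card (edges G) + card A * card B = card (pverts G) choose 2; u \<in> pverts G; v \<in> pverts G;
      u \<noteq> v; (u, v) \<notin> A \<times> B \<union> B \<times> A\<rbrakk> \<Longrightarrow> (u, v) \<in> parcs G"
proof -
  define P where "P = {e. e \<subseteq> pverts G \<and> card e = 2}"
  define X where "X = (\<lambda>(u, v). {u, v}) ` (A \<times> B)"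
  have sep: "pverts G = S \<union> A \<union> B" "A \<inter> B = {}" "parcs G \<inter> (A \<times> B \<union> B \<times> A) = {}"
    using assms by (auto simp: separation_def)
  have finP: "finite P" and cardP: "card P = card (pverts G) choose 2"
    using n_subsets[OF pair_finite_verts, of 2] pair_finite_verts by (auto simp: P_def)
  \<comment> \<open>As \<open>A\<close> and \<open>B\<close> are disjoint, an unordered pair
    determines which element comes from \<open>A\<close>.\<close>
  have "inj_on (\<lambda>(u, v). {u, v}) (A \<times> B)"
    using sep(2) by (auto simp: inj_on_def doubleton_eq_iff)
  then have cardX: "card X = card A * card B"
    by (simp add: X_def card_image card_cartesian_product)
  have sub: "edges G \<union> X \<subseteq> P"
    using sep(1,2) wellformed' no_loop
    by (fastforce simp: edges_def X_def P_def card_insert_if)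
  have disj: "edges G \<inter> X = {}"
    using sep(3) by (fastforce simp: edges_def X_def doubleton_eq_iff)
  have card_un: "card (edges G \<union> X) = card (edges G) + card A * card B"
    using sub disj finP cardX by (metis card_Un_disjoint finite_subset le_sup_iff)
  then show "card (edges G) + card A * card B \<le> card (pverts G) choose 2"
    using card_mono[OF finP sub] cardP by simp
  assume eq: "card (edges G) + card A * card B = card (pverts G) choose 2"
    and uv: "u \<in> pverts G" "v \<in> pverts G" "u \<noteq> v" "(u, v) \<notin> A \<times> B \<union> B \<times> A"
  have "edges G \<union> X = P"
    using sub finP cardP card_un eq by (metis card_subset_eq)
  moreover have "{u, v} \<in> P"
    using uv by (auto simp: P_def)
  moreover have "{u, v} \<notin> X"
    using uv(4) by (auto simp: X_def doubleton_eq_iff)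
  ultimately have "{u, v} \<in> edges G"
    by blast
  then show "(u, v) \<in> parcs G"
    using arcs_symmetric by (auto simp: edges_def doubleton_eq_iff)
qed

lemma arcs_full_separation:
  assumes sep: "separation G S A B"
    and full: "card (edges G) + card A * card B = card (pverts G) choose 2"
  shows "(u, v) \<in> parcs G \<longleftrightarrow>
    u \<in> pverts G \<and> v \<in> pverts G \<and> u \<noteq> v \<and> (u, v) \<notin> A \<times> B \<union> B \<times> A"
proof
  assume uv: "(u, v) \<in> parcs G"
  then have "u \<in> pverts G" "v \<in> pverts G" "u \<noteq> v"
    using wellformed' no_loop by blast+
  moreover have "(u, v) \<notin> A \<times> B \<union> B \<times> A"
    using uv sep unfolding separation_def by blast
  ultimately show "u \<in> pverts G \<and> v \<in> pverts G \<and> u \<noteq> v \<and> (u, v) \<notin> A \<times> B \<union> B \<times> A"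
    by blast
qed (use card_edges_separation(2)[OF sep full] in blast)

text \<open>The summand 1 counts the chosen vertex of \<open>A\<close> itself, which is not its own
  neighbour. When \<open>S\<close> is smaller than the minimum degree, this forces \<open>A\<close>
  to have at least two vertices.\<close>

lemma min_degree_separation:
  assumes "separation G S A B"
  shows "min_degree G + 1 \<le> card A + card S"
proof -
  obtain v where v: "v \<in> A"
    using assms by (auto simp: separation_def)
  have fin: "finite A" "finite S"
    using assms pair_finite_verts by (auto simp: separation_def)
  have "{w. (v, w) \<in> parcs G} \<subseteq> (A - {v}) \<union> S"
    using assms v wellformed' no_loop by (fastforce simp: separation_def)
  then have "card {w. (v, w) \<in> parcs G} \<le> card (A - {v}) + card S"
    using fin by (meson card_Un_le card_mono finite_Diff finite_UnI le_trans)
  moreover have "min_degree G \<le> card {w. (v, w) \<in> parcs G}"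
    using assms v by (intro min_degree_le) (auto simp: separation_def)
  moreover have "card (A - {v}) + 1 = card A"
    using card_Suc_Diff1[OF fin(1) v] by simp
  ultimately show ?thesis
    by linarith
qed

lemma card_verts_separation:
  assumes "separation G S A B"
  shows "card (pverts G) = card S + card A + card B"
proof -
  have "finite S" "finite A" "finite B"
    using assms pair_finite_verts by (auto simp: separation_def)
  then show ?thesis
    using assms by (simp add: separation_def card_Un_disjoint Int_Un_distrib2)
qed

text \<open>In the tight case the closed neighbourhood of a vertex is everything,
  \<open>A \<union> S\<close> or \<open>B \<union> S\<close>, according to the part containing it.
  This excludes the sporadic sizes in (b).\<close>

lemma min_degree_full_separation:
  assumes sep: "separation G S A B"
    and full: "card (edges G) + card A * card B = card (pverts G) choose 2"
  shows "min_degree G + 1 \<in> {card (pverts G), card A + card S, card B + card S}"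
proof -
  have fin: "finite A" "finite B" "finite S"
    using sep pair_finite_verts by (auto simp: separation_def)
  note arcs = arcs_full_separation[OF sep full]
  obtain v where v: "v \<in> pverts G" "card {w. (v, w) \<in> parcs G} = min_degree G"
    using min_degree_attained sep by (metis Un_empty separation_def)
  then consider "v \<in> S" | "v \<in> A" | "v \<in> B"
    using sep by (auto simp: separation_def)
  then show ?thesis
  proof cases
    case 1
    then have "{w. (v, w) \<in> parcs G} = pverts G - {v}"
      using sep by (auto simp: arcs separation_def)
    then show ?thesis
      using v pair_finite_verts by (metis card.remove insertI1 Suc_eq_plus1)
  next
    case 2
    then have "insert v {w. (v, w) \<in> parcs G} = A \<union> S"
      using sep by (auto simp: arcs separation_def)
    moreover have "card (insert v {w. (v, w) \<in> parcs G}) = min_degree G + 1"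
      using v neighbours_subset[of v] pair_finite_verts
      by (subst card_insert_disjoint) (auto intro: finite_subset[of _ "pverts G"])
    ultimately show ?thesis
      using sep fin by (auto simp: separation_def card_Un_disjoint Int_commute)
  next
    case 3
    then have "insert v {w. (v, w) \<in> parcs G} = B \<union> S"
      using sep by (auto simp: arcs separation_def)
    moreover have "card (insert v {w. (v, w) \<in> parcs G}) = min_degree G + 1"
      using v neighbours_subset[of v] pair_finite_verts
      by (subst card_insert_disjoint) (auto intro: finite_subset[of _ "pverts G"])
    ultimately show ?thesis
      using sep fin by (auto simp: separation_def card_Un_disjoint Int_commute)
  qed
qed

section \<open>Comparison with the exceptional graph\<close>

text \<open>Arcs are pairs of vertices, so an injective relabelling acts on them by
  \<open>map_prod f f\<close>, and tail and head remain \<open>fst\<close> and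
  \<open>snd\<close>.\<close>

lemma digraph_iso_image:
  assumes "inj_on f (pverts G)"
  shows "digraph_iso G (with_proj \<lparr>pverts = f ` pverts G, parcs = map_prod f f ` parcs G\<rparr>)"
proof -
  define hom where "hom = \<lparr>iso_verts = f, iso_arcs = map_prod f f, iso_head = snd, iso_tail = fst\<rparr>"
  have "inj_on (map_prod f f) (parcs G)"
    by (rule inj_on_subset[OF map_prod_inj_on[OF assms assms]]) (auto dest: wellformed')
  then have "digraph_isomorphism hom"
    using assms wf_digraph_axioms by (auto simp: digraph_isomorphism_def hom_def)
  moreover have "with_proj \<lparr>pverts = f ` pverts G, parcs = map_prod f f ` parcs G\<rparr> = app_iso hom G"
    by (simp add: app_iso_def hom_def with_proj_def)
  ultimately show ?thesis
    unfolding digraph_iso_def by blast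
qed

end

lemma verts_exceptional_graph:
  "pverts (exceptional_graph n d) = {..<d - 1} <+> ({..<2} <+> {..<n - d - 1})"
  by (simp add: exceptional_graph_def join_def disjoint_union_def complete_graph_def)

lemma arcs_exceptional_graph:
  "(u, v) \<in> parcs (exceptional_graph n d) \<longleftrightarrow>
     u \<in> pverts (exceptional_graph n d) \<and> v \<in> pverts (exceptional_graph n d) \<and> u \<noteq> v \<and>
     \<not> ((\<exists>i. u = Inr (Inl i)) \<and> (\<exists>j. v = Inr (Inr j))) \<and>
     \<not> ((\<exists>i. u = Inr (Inr i)) \<and> (\<exists>j. v = Inr (Inl j)))"
  by (cases u; cases v; (cases "projr u")?; (cases "projr v")?;
    auto simp: exceptional_graph_def join_def disjoint_union_def complete_graph_def image_iff; force)

lemma pair_graph_exceptional_graph: "pair_graph (exceptional_graph n d)"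
  unfolding exceptional_graph_def
  by (intro pair_graph_join_aux pair_graph_complete_graph)

context pair_graph
begin

lemma separation_embedding:
  assumes sep: "separation G S A B"
    and card: "card S = d - 1" "card A = 2" "card B = n - d - 1"
  obtains f where "bij_betw f (pverts G) (pverts (exceptional_graph n d))"
    and "\<And>u v. \<lbrakk>u \<in> pverts G; v \<in> pverts G\<rbrakk> \<Longrightarrow>
      (f u, f v) \<in> parcs (exceptional_graph n d) \<longleftrightarrow> u \<noteq> v \<and> (u, v) \<notin> A \<times> B \<union> B \<times> A"
proof -
  have fin: "finite A" "finite B" "finite S"
    using sep pair_finite_verts by (auto simp: separation_def)
  obtain f1 f2 f3 where bij: "bij_betw f1 S {..<d - 1}" "bij_betw f2 A {..<2::nat}"
    "bij_betw f3 B {..<n - d - 1}"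
    using fin card by (metis bij_betw_iff_card card_lessThan finite_lessThan)
  define f where "f v = (if v \<in> S then Inl (f1 v) else if v \<in> A then Inr (Inl (f2 v))
    else Inr (Inr (f3 v)))" for v
  have V: "pverts G = S \<union> A \<union> B" "S \<inter> A = {}" "S \<inter> B = {}" "A \<inter> B = {}"
    using sep by (auto simp: separation_def)
  have inj: "inj_on f (pverts G)"
    using bij by (auto simp: inj_on_def f_def V(1) bij_betw_def)
  have "f ` S = Inl ` f1 ` S" "f ` A = Inr ` Inl ` f2 ` A" "f ` B = Inr ` Inr ` f3 ` B"
    unfolding image_image using V by (auto intro!: image_cong simp: f_def)
  then have "f ` pverts G = pverts (exceptional_graph n d)"
    using bij by (simp add: V(1) image_Un verts_exceptional_graph Plus_def bij_betw_def Un_assoc)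
  then have bf: "bij_betw f (pverts G) (pverts (exceptional_graph n d))"
    using inj by (simp add: bij_betw_def)
  moreover have "(f u, f v) \<in> parcs (exceptional_graph n d) \<longleftrightarrow> u \<noteq> v \<and> (u, v) \<notin> A \<times> B \<union> B \<times> A"
    if uv: "u \<in> pverts G" "v \<in> pverts G" for u v
  proof -
    have "f u \<in> pverts (exceptional_graph n d)" "f v \<in> pverts (exceptional_graph n d)"
      "f u = f v \<longleftrightarrow> u = v"
      using uv bf inj by (auto simp: bij_betw_def inj_on_eq_iff)
    moreover have "(\<exists>i. f w = Inr (Inl i)) \<longleftrightarrow> w \<in> A" "(\<exists>i. f w = Inr (Inr i)) \<longleftrightarrow> w \<in> B"
      if "w \<in> pverts G" for w
      using that V by (auto simp: f_def)
    ultimately show ?thesis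
      using uv by (simp add: arcs_exceptional_graph)
  qed
  ultimately show ?thesis
    using that by blast
qed

lemma separation_subgraph_exceptional_graph:
  assumes sep: "separation G S A B"
    and card: "card S = d - 1" "card A = 2" "card B = n - d - 1"
  shows "\<exists>H :: (nat + (nat + nat)) pair_pre_digraph.
    subgraph H (exceptional_graph n d) \<and> digraph_iso G H"
proof -
  interpret E: pair_graph "exceptional_graph n d" by (rule pair_graph_exceptional_graph)
  obtain f where f: "bij_betw f (pverts G) (pverts (exceptional_graph n d))"
    "\<And>u v. \<lbrakk>u \<in> pverts G; v \<in> pverts G\<rbrakk> \<Longrightarrow>
      (f u, f v) \<in> parcs (exceptional_graph n d) \<longleftrightarrow> u \<noteq> v \<and> (u, v) \<notin> A \<times> B \<union> B \<times> A"
    using separation_embedding[OF assms] by blast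
  define H where "H = \<lparr>pverts = f ` pverts G, parcs = map_prod f f ` parcs G\<rparr>"
  have "pverts H \<subseteq> pverts (exceptional_graph n d)"
    using f(1) by (simp add: H_def bij_betw_def)
  moreover have "parcs H \<subseteq> parcs (exceptional_graph n d)"
  proof (clarsimp simp: H_def)
    fix u v assume uv: "(u, v) \<in> parcs G"
    then have "u \<noteq> v" "(u, v) \<notin> A \<times> B \<union> B \<times> A"
      using sep no_loop unfolding separation_def by blast+
    then show "(f u, f v) \<in> parcs (exceptional_graph n d)"
      using f(2) uv wellformed' by blast
  qed
  moreover have "pair_wf_digraph H"
    using wellformed' by unfold_locales (auto simp: H_def)
  ultimately have "subgraph H (exceptional_graph n d)"
    using E.wf_digraph_axioms by (auto simp: subgraph_def compatible_def wf_digraph_wp_iff)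
  moreover have "digraph_iso G H"
    unfolding H_def using f(1) by (intro digraph_iso_image) (simp add: bij_betw_def)
  ultimately show ?thesis by blast
qed

lemma full_separation_iso_exceptional_graph:
  assumes sep: "separation G S A B"
    and card: "card S = d - 1" "card A = 2" "card B = n - d - 1"
    and full: "card (edges G) + card A * card B = card (pverts G) choose 2"
  shows "digraph_iso G (exceptional_graph n d)"
proof -
  interpret E: pair_graph "exceptional_graph n d" by (rule pair_graph_exceptional_graph)
  obtain f where f: "bij_betw f (pverts G) (pverts (exceptional_graph n d))"
    "\<And>u v. \<lbrakk>u \<in> pverts G; v \<in> pverts G\<rbrakk> \<Longrightarrow>
      (f u, f v) \<in> parcs (exceptional_graph n d) \<longleftrightarrow> u \<noteq> v \<and> (u, v) \<notin> A \<times> B \<union> B \<times> A"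
    using separation_embedding[OF sep card] by blast
  note arcs = arcs_full_separation[OF sep full]
  have "x \<in> map_prod f f ` parcs G" if x: "x \<in> parcs (exceptional_graph n d)" for x
  proof -
    obtain a b where ab: "x = (a, b)" by (cases x)
    then have "a \<in> f ` pverts G" "b \<in> f ` pverts G"
      using x f(1) E.wellformed' by (auto simp: bij_betw_def)
    then obtain u v where "u \<in> pverts G" "v \<in> pverts G" "x = (f u, f v)"
      using ab by blast
    then show ?thesis
      using x f(2) arcs by force
  qed
  then have "exceptional_graph n d = \<lparr>pverts = f ` pverts G, parcs = map_prod f f ` parcs G\<rparr>"
    using f arcs by (intro pair_pre_digraph.equality) (auto simp: bij_betw_def)
  then show ?thesis
    using digraph_iso_image[of f] f(1) by (simp add: bij_betw_def)
qed

end

text \<open>With \<open>d = \<delta>\<close> and \<open>k = |S|\<close>, both bounds come from expanding \<open>a * b = (x + s) * (y + s)\<close> for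
  \<open>s = d - k + 1\<close> and \<open>n = a + b + k\<close>: this is \<open>x * y + s * (n - d - 1)\<close>.\<close>

lemma product_le_twice:
  fixes a b k d :: nat
  assumes "k < d" "d + 1 \<le> a + k" "d + 1 \<le> b + k" "a * b \<le> 2 * (a + b + k - d - 1)"
  shows "k = d - 1 \<and> (a = 2 \<or> b = 2) \<and> a * b = 2 * (a + b + k - d - 1)"
proof -
  define t where "t = d - 1 - k"
  obtain x where a: "a = x + t + 2"
    using that[of "a - t - 2"] assms by (simp add: t_def)
  obtain y where b: "b = y + t + 2"
    using that[of "b - t - 2"] assms by (simp add: t_def)
  have k: "d = k + 1 + t"
    using assms by (simp add: t_def)
  have "x * y + t * (x + y + t + 2) \<le> 0"
    using assms(4) unfolding a b k by (simp add: algebra_simps)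
  then have "x * y = 0" "t = 0"
    by auto
  then show ?thesis
    unfolding a b k by auto
qed

lemma product_le_sparse:
  fixes a b k d :: nat
  assumes "k < d" "d + 1 \<le> a + k" "d + 1 \<le> b + k" "2 * d + 3 \<le> a + b + k"
    and "a * b + d + 3 \<le> 2 * (a + b + k)"
  shows "k = d - 1 \<and>
    (a = 2 \<or> b = 2 \<or> {a, b} = {3, d + 1} \<and> a * b + d + 3 = 2 * (a + b + k))"
proof -
  define t where "t = d - 1 - k"
  obtain x where a: "a = x + t + 2"
    using that[of "a - t - 2"] assms by (simp add: t_def)
  obtain y where b: "b = y + t + 2"
    using that[of "b - t - 2"] assms by (simp add: t_def)
  have k: "d = k + 1 + t"
    using assms by (simp add: t_def)
  have d: "k + 1 \<le> x + y"
    using assms(4) unfolding a b k by simp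
  have le: "x * y + t * (x + y + t + 2) \<le> k + t"
    using assms(5) unfolding a b k by (simp add: algebra_simps)
  have t: "t = 0"
  proof (rule ccontr)
    assume "t \<noteq> 0"
    then have "1 * (x + y + t + 2) \<le> t * (x + y + t + 2)"
      by (intro mult_le_mono1) simp
    then have "x + y + t + 2 \<le> k + t"
      using le by simp
    then show False
      using d by simp
  qed
  have "a = 2 \<or> b = 2 \<or> {a, b} = {3, d + 1} \<and> a * b + d + 3 = 2 * (a + b + k)"
  proof (cases x; cases y)
    fix x' y' assume xy: "x = Suc x'" "y = Suc y'"
    then have "x' * y' + x' + y' + 1 \<le> k" and k': "k \<le> x' + y' + 1"
      using le d t by simp_all
    then have "x' * y' < 1"
      by linarith
    then have "x' * y' = 0" "k = x' + y' + 1"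
      using \<open>x' * y' + x' + y' + 1 \<le> k\<close> k' by simp_all
    then show ?thesis
      unfolding a b k t xy by auto
  qed (use a b t in auto)
  then show ?thesis
    using k t by simp
qed

theorem theorem3p1:
  fixes G :: "'a pair_pre_digraph" and n m \<delta> \<kappa> :: nat
  assumes "pair_graph G" and "Digraph_Component.connected G"
    and "n = card (pverts G)" and "n \<ge> 5"
    and "m = card (edges G)"
    and "\<delta> = min_degree G" and "\<delta> \<ge> 2"
    and "\<kappa> = vertex_connectivity G"
  shows
    "(m \<ge> ((n - 2) choose 2) + 2 * \<delta> - 1 \<longrightarrow>
        \<not> digraph_iso G (exceptional_graph n \<delta>) \<longrightarrow> \<kappa> = \<delta>) \<and>
     (n \<ge> 2 * \<delta> + 3 \<and> m \<ge> ((n - 2) choose 2) + \<delta> \<longrightarrow>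
        \<not> (\<exists>H :: (nat + (nat + nat)) pair_pre_digraph.
             subgraph H (exceptional_graph n \<delta>) \<and> digraph_iso G H) \<longrightarrow> \<kappa> = \<delta>)"
proof -
  interpret pair_graph G by fact
  have "pverts G \<noteq> {}"
    using assms by auto
  then show ?thesis
  proof (cases rule: vertex_connectivity_cases)
    case eq
    then show ?thesis
      using assms by simp
  next
    case (less S A B)
    note sep = less(1)
    define a b k where "a = card A" and "b = card B" and "k = card S"
    note abk = a_def[symmetric] b_def[symmetric] k_def[symmetric]
    have n: "n = a + b + k"
      using card_verts_separation[OF sep] assms abk by simp
    have k: "k < \<delta>"
      using less(2) assms abk by simp
    have da: "\<delta> + 1 \<le> a + k"
      using min_degree_separation[OF sep] assms abk by simp
    have db: "\<delta> + 1 \<le> b + k"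
      using min_degree_separation[OF separation_swap[OF sep]] assms abk by simp
    have bound: "m + a * b \<le> n choose 2"
      using card_edges_separation(1)[OF sep] assms abk by simp
    obtain n' where n': "n = Suc (Suc n')"
      using that[of "n - 2"] assms(4) by simp
    have "n choose 2 = ((n - 2) choose 2) + (2 * n - 3)"
      unfolding n' by (simp add: numeral_2_eq_2)
    then have choose: "(n choose 2) + 3 = ((n - 2) choose 2) + 2 * n"
      using assms(4) by simp
    have iso: "digraph_iso G (exceptional_graph n \<delta>)"
      if m: "m \<ge> ((n - 2) choose 2) + 2 * \<delta> - 1"
    proof -
      have "a * b \<le> 2 * (a + b + k - \<delta> - 1)"
        using m bound choose n k da assms(4,7) by linarith
      from product_le_twice[OF k da db this]
      have ab: "k = \<delta> - 1" "a = 2 \<or> b = 2" "a * b = 2 * (a + b + k - \<delta> - 1)"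
        by auto
      then have full: "m + a * b = n choose 2"
        using m bound choose n k da assms(4,7) by linarith
      from ab(2) show ?thesis
      proof
        assume "a = 2"
        then show ?thesis
          using sep ab(1) full n k assms(3,5)
          by (intro full_separation_iso_exceptional_graph[of S A B]) (auto simp: abk)
      next
        assume "b = 2"
        then show ?thesis
          using separation_swap[OF sep] ab(1) full n k assms(3,5)
          by (intro full_separation_iso_exceptional_graph[of S B A]) (auto simp: abk mult.commute)
      qed
    qed
    have sub: "\<exists>H :: (nat + (nat + nat)) pair_pre_digraph.
        subgraph H (exceptional_graph n \<delta>) \<and> digraph_iso G H"
      if m: "n \<ge> 2 * \<delta> + 3" "m \<ge> ((n - 2) choose 2) + \<delta>"
    proof -
      have "2 * \<delta> + 3 \<le> a + b + k"
        using m n by simp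
      moreover have "a * b + \<delta> + 3 \<le> 2 * (a + b + k)"
        unfolding n[symmetric] using m(2) bound choose by linarith
      ultimately consider "k = \<delta> - 1" "a = 2" | "k = \<delta> - 1" "b = 2"
        | "k = \<delta> - 1" "{a, b} = {3, \<delta> + 1}" "a * b + \<delta> + 3 = 2 * (a + b + k)"
        using product_le_sparse[OF k da db] by blast
      then show ?thesis
      proof cases
        case 1
        then show ?thesis
          using sep n k by (intro separation_subgraph_exceptional_graph[of S A B]) (auto simp: abk)
      next
        case 2
        then show ?thesis
          using separation_swap[OF sep] n k
          by (intro separation_subgraph_exceptional_graph[of S B A]) (auto simp: abk)
      next
        case 3
        have "m + a * b = n choose 2"
          using m(2) bound choose 3(3)[folded n] by linarith
        then have "\<delta> + 1 \<in> {n, a + k, b + k}"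
          using min_degree_full_separation[OF sep] assms(3,5,6) by (simp add: abk)
        then show ?thesis
          using 3(1,2) m(1) assms(7) by (auto simp: doubleton_eq_iff)
      qed
    qed
    show ?thesis
      using iso sub by blast
  qed
qed

end
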